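(* Suppose that the random parameter vector $a\in\mathbb{R}^m_{++}$ follows the lognormal distribution with mean $\mu$ and covariance matrix $\Sigma$, and that the components $a_1,\dots,a_m$ are independent. Let $\mu^{\ln}$ and $\Sigma^{\ln}$ be the mean vector and covariance matrix of the normally distributed random vector $\ln a=(\ln a_1,\dots,\ln a_m)^{\top}$, and let $\lambda$ be the maximum eigenvalue of the diagonal matrix $\Sigma^{\ln}$. Set $a^0_i=\exp(\mu^{\ln}_i)$, $i=1,\dots,m$, and $A=(\Sigma^{\ln})^{-1/2}$, and use the $\ell_2$-norm in the definition of the uncertainty set $\Omega(a^0,\tau,A)$. Let $f:\mathbb{R}^m\times\mathbb{R}^n\to\mathbb{R}$. If, for $0<\varepsilon<1$, $$\tau\ge\delta(\varepsilon)\left(\exp\left(\lambda^{1/2}\delta(\varepsilon)\right)-1\right),\qquad\text{where}\quad\delta(\varepsilon)=\sqrt{F^{-1}(m,1-\varepsilon)},$$ then, for every robust feasible solution $x(\tau)$, i.e. every $x(\tau)\in\mathbb{R}^n$ with $$\min_{a\in\Omega(a^0,\tau,A)}f(a,x(\tau))\ge 0,$$ it holds that $$\mathbb{P}\left(f(a,x(\tau))\ge 0\right)\ge 1-\varepsilon.$$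
   Context: $\mathbb{R}^m_{++}$ is the set of vectors with all entries positive. With $A^0=\operatorname{diag}(a^0)$, $\tau\ge 0$ and the $\ell_2$-norm, the uncertainty set is $$\Omega(a^0,\tau,A)=\{a\in\mathbb{R}^m:\exists z,y\in\mathbb{R}^m,\ z_i>0,\ a=A^0z,\ z_i-\ln z_i-1\le y_i\ (i=1,\dots,m),\ \|Ay\|_2\le\tau\}.$$ By independence, $\Sigma$ and $\Sigma^{\ln}$ are diagonal, and with $\sigma_i^2=\Sigma_{i,i}$ (so that $\Sigma^{\ln}$ is invertible when all $\sigma_i^2>0$) $$\mu^{\ln}_i=\ln\mu_i-\tfrac12\ln\left(1+\frac{\sigma_i^2}{\mu_i^2}\right),\qquad(\Sigma^{\ln})_{i,i}=\ln\left(1+\frac{\sigma_i^2}{\mu_i^2}\right).$$ $\Sigma^{\ln}$ is invertible (implicit in the definition of $A$). $F(\nu,\cdot)$ is the distribution function of the $\chi^2$-distribution with $\nu$ degrees of freedom, and $F^{-1}(\nu,\cdot)$ is the inverse of $F(\nu,\cdot)$ (the quantile function). No convexity or monotonicity assumption is made on $f$. *)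

theory Defs
  imports "HOL-Probability.Probability"
begin

section \<open>Random vectors\<close>

definition mean_vector :: "'w measure \<Rightarrow> ('w \<Rightarrow> real^'m) \<Rightarrow> real^'m" where
  "mean_vector M X = (\<chi> i. \<integral>\<omega>. X \<omega> $ i \<partial>M)"

definition covariance_matrix :: "'w measure \<Rightarrow> ('w \<Rightarrow> real^'m) \<Rightarrow> real^'m^'m" where
  "covariance_matrix M X =
     (\<chi> i j. \<integral>\<omega>. (X \<omega> $ i - mean_vector M X $ i) * (X \<omega> $ j - mean_vector M X $ j) \<partial>M)"

text \<open>As usual for Gaussian vectors, constants count as normal with variance 0.\<close>

definition normal_rv :: "'w measure \<Rightarrow> ('w \<Rightarrow> real) \<Rightarrow> bool" where
  "normal_rv M X \<longleftrightarrow>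
     (\<exists>m \<sigma>. 0 < \<sigma> \<and> distributed M lborel X (normal_density m \<sigma>)) \<or>
     (X \<in> borel_measurable M \<and> (\<exists>m. AE \<omega> in M. X \<omega> = m))"

definition multivariate_normal :: "'w measure \<Rightarrow> ('w \<Rightarrow> real^'m) \<Rightarrow> bool" where
  "multivariate_normal M X \<longleftrightarrow> (\<forall>t. normal_rv M (\<lambda>\<omega>. t \<bullet> X \<omega>))"

definition vec_ln :: "real^'m \<Rightarrow> real^'m" where
  "vec_ln v = (\<chi> i. ln (v $ i))"

text \<open>\<open>\<mu>\<close> and \<open>S\<close> are the mean and covariance of \<open>a\<close> itself, not the parameters of the
  underlying normal vector \<open>ln a\<close>; the lemma \<open>lognormal_parameters\<close> below relates the two.
  All moments of a lognormal vector are finite, so the integrals exist.\<close>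

definition lognormal_vector ::
    "'w measure \<Rightarrow> ('w \<Rightarrow> real^'m) \<Rightarrow> real^'m \<Rightarrow> real^'m^'m \<Rightarrow> bool" where
  "lognormal_vector M a \<mu> S \<longleftrightarrow>
     a \<in> borel_measurable M \<and>
     (\<forall>\<omega>\<in>space M. \<forall>i. 0 < a \<omega> $ i) \<and>
     multivariate_normal M (\<lambda>\<omega>. vec_ln (a \<omega>)) \<and>
     mean_vector M a = \<mu> \<and>
     covariance_matrix M a = S"

lemma normal_density_exp:
  assumes "0 < \<sigma>"
  shows "has_bochner_integral lborel (\<lambda>x. normal_density m \<sigma> x * exp (k * x))
           (exp (k * m + k\<^sup>2 * \<sigma>\<^sup>2 / 2))"
proof -
  have "normal_density m \<sigma> x * exp (k * x)
      = exp (k * m + k\<^sup>2 * \<sigma>\<^sup>2 / 2) * normal_density (m + k * \<sigma>\<^sup>2) \<sigma> x" for x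
  proof -
    have "- (x - m)\<^sup>2 / (2 * \<sigma>\<^sup>2) + k * x
        = (k * m + k\<^sup>2 * \<sigma>\<^sup>2 / 2) + - (x - (m + k * \<sigma>\<^sup>2))\<^sup>2 / (2 * \<sigma>\<^sup>2)"
      using assms by (simp add: field_simps power2_eq_square)
    then show ?thesis
      by (simp add: normal_density_def exp_add[symmetric] mult.assoc mult.left_commute)
  qed
  moreover have "has_bochner_integral lborel (normal_density (m + k * \<sigma>\<^sup>2) \<sigma>) 1"
    using assms by (simp add: has_bochner_integral_iff)
  ultimately show ?thesis
    using has_bochner_integral_mult_right[of "exp (k * m + k\<^sup>2 * \<sigma>\<^sup>2 / 2)" lborel
        "normal_density (m + k * \<sigma>\<^sup>2) \<sigma>" 1]
    by simp
qed

lemma normal_rv_exp: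
  assumes "prob_space M" and X: "normal_rv M X"
  shows "has_bochner_integral M (\<lambda>\<omega>. exp (k * X \<omega>))
    (exp (k * (\<integral>\<omega>. X \<omega> \<partial>M) + k\<^sup>2 * (\<integral>\<omega>. (X \<omega> - (\<integral>\<omega>. X \<omega> \<partial>M))\<^sup>2 \<partial>M) / 2))"
proof -
  interpret prob_space M by fact
  show ?thesis
    using X unfolding normal_rv_def
  proof (elim disjE exE conjE)
    fix m \<sigma> assume \<sigma>: "0 < \<sigma>" and D: "distributed M lborel X (normal_density m \<sigma>)"
    have E: "expectation X = m"
      using normal_distributed_expectation[OF \<sigma> D] .
    have V: "variance X = \<sigma>\<^sup>2"
      using normal_distributed_variance[OF \<sigma> D] .
    have "integrable M (\<lambda>\<omega>. exp (k * X \<omega>))"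
      using distributed_integrable[OF D, of "\<lambda>x. exp (k * x)"] normal_density_exp[OF \<sigma>]
      by (simp add: has_bochner_integral_iff)
    moreover have "expectation (\<lambda>\<omega>. exp (k * X \<omega>)) = exp (k * m + k\<^sup>2 * \<sigma>\<^sup>2 / 2)"
      using distributed_integral[OF D, of "\<lambda>x. exp (k * x)"] normal_density_exp[OF \<sigma>]
      by (simp add: has_bochner_integral_iff)
    ultimately show ?thesis
      unfolding E V[unfolded E] by (simp add: has_bochner_integral_iff)
  next
    fix m assume [measurable]: "X \<in> borel_measurable M" and ae: "AE \<omega> in M. X \<omega> = m"
    have E: "expectation X = m"
      using integral_cong_AE[of X M "\<lambda>_. m"] ae by (simp add: prob_space)
    have V: "expectation (\<lambda>\<omega>. (X \<omega> - m)\<^sup>2) = 0"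
      by (rule integral_eq_zero_AE) (use ae in auto)
    have "has_bochner_integral M (\<lambda>\<omega>. exp (k * X \<omega>)) (exp (k * m))
        \<longleftrightarrow> has_bochner_integral M (\<lambda>_. exp (k * m)) (exp (k * m))"
      by (rule has_bochner_integral_cong_AE) (use ae in auto)
    then show ?thesis
      unfolding E V by (simp add: has_bochner_integral_iff prob_space)
  qed
qed

lemma lognormal_parameters:
  assumes "prob_space M" and a: "lognormal_vector M a \<mu> S"
  shows "mean_vector M (\<lambda>\<omega>. vec_ln (a \<omega>)) $ i
           = ln (\<mu> $ i) - 1/2 * ln (1 + S $ i $ i / (\<mu> $ i)\<^sup>2)"
    and "covariance_matrix M (\<lambda>\<omega>. vec_ln (a \<omega>)) $ i $ i
           = ln (1 + S $ i $ i / (\<mu> $ i)\<^sup>2)"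
proof -
  interpret prob_space M by fact
  define X where "X = (\<lambda>\<omega>. ln (a \<omega> $ i))"
  have "normal_rv M (\<lambda>\<omega>. axis i 1 \<bullet> vec_ln (a \<omega>))"
    using a by (simp only: lognormal_vector_def multivariate_normal_def)
  then have N: "normal_rv M X"
    by (simp add: X_def vec_ln_def inner_axis')
  define m v where "m = expectation X" and "v = expectation (\<lambda>\<omega>. (X \<omega> - m)\<^sup>2)"
  have mgf: "has_bochner_integral M (\<lambda>\<omega>. exp (k * X \<omega>)) (exp (k * m + k\<^sup>2 * v / 2))" for k
    using normal_rv_exp[OF \<open>prob_space M\<close> N, of k] by (simp add: m_def v_def)
  have pos: "0 < a \<omega> $ i" if "\<omega> \<in> space M" for \<omega>
    using a that by (auto simp: lognormal_vector_def)
  have h1: "has_bochner_integral M (\<lambda>\<omega>. a \<omega> $ i) (exp (m + v / 2))"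
    using mgf[of 1] by (subst has_bochner_integral_cong) (auto simp: X_def pos)
  have h2: "has_bochner_integral M (\<lambda>\<omega>. (a \<omega> $ i)\<^sup>2) (exp (2 * m + 2 * v))"
    using mgf[of 2]
    by (subst has_bochner_integral_cong)
       (auto simp: X_def pos exp_double)
  have \<mu>: "\<mu> $ i = exp (m + v / 2)"
    using a h1 by (auto simp: lognormal_vector_def mean_vector_def has_bochner_integral_iff)
  have "S $ i $ i = variance (\<lambda>\<omega>. a \<omega> $ i)"
    using a by (auto simp: lognormal_vector_def covariance_matrix_def mean_vector_def power2_eq_square)
  also have "\<dots> = exp (2 * m + 2 * v) - (exp (m + v / 2))\<^sup>2"
    using h1 h2 by (subst variance_eq) (auto simp: has_bochner_integral_iff)
  finally have "1 + S $ i $ i / (\<mu> $ i)\<^sup>2 = exp (2 * m + 2 * v) / (exp (m + v / 2))\<^sup>2"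
    by (simp add: \<mu> field_simps)
  also have "\<dots> = exp v"
    by (simp add: exp_double[symmetric] exp_diff[symmetric] algebra_simps)
  finally have L: "ln (1 + S $ i $ i / (\<mu> $ i)\<^sup>2) = v"
    by simp
  show "covariance_matrix M (\<lambda>\<omega>. vec_ln (a \<omega>)) $ i $ i = ln (1 + S $ i $ i / (\<mu> $ i)\<^sup>2)"
    unfolding L by (simp add: covariance_matrix_def mean_vector_def vec_ln_def v_def m_def X_def
        power2_eq_square)
  show "mean_vector M (\<lambda>\<omega>. vec_ln (a \<omega>)) $ i
      = ln (\<mu> $ i) - 1/2 * ln (1 + S $ i $ i / (\<mu> $ i)\<^sup>2)"
    unfolding L by (simp add: \<mu> mean_vector_def vec_ln_def m_def X_def)
qed


section \<open>Matrices\<close>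

definition diag_matrix :: "real^'m \<Rightarrow> real^'m^'m" where
  "diag_matrix d = (\<chi> i j. if i = j then d $ i else 0)"

definition max_eigenvalue :: "real^'m^'m \<Rightarrow> real" where
  "max_eigenvalue S = Max {c. \<exists>v. v \<noteq> 0 \<and> S *v v = c *\<^sub>R v}"

definition psd :: "real^'m^'m \<Rightarrow> bool" where
  "psd S \<longleftrightarrow> transpose S = S \<and> (\<forall>v. 0 \<le> v \<bullet> (S *v v))"

text \<open>The principal square root, meaningful for positive semidefinite \<open>S\<close> only.\<close>

definition matrix_sqrt :: "real^'m^'m \<Rightarrow> real^'m^'m" where
  "matrix_sqrt S = (THE B. psd B \<and> B ** B = S)"


section \<open>The chi-squared distribution\<close>

definition chi_squared :: "nat \<Rightarrow> real measure" where
  "chi_squared \<nu> =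
     distr (Pi\<^sub>M {..<\<nu>} (\<lambda>_. density lborel std_normal_density)) borel (\<lambda>g. \<Sum>i<\<nu>. (g i)\<^sup>2)"

text \<open>For \<open>\<nu> \<ge> 1\<close> the distribution function is a bijection from \<open>{0<..}\<close> onto \<open>{0<..<1}\<close>;
  this is its inverse.\<close>

definition chi_squared_quantile :: "nat \<Rightarrow> real \<Rightarrow> real" where
  "chi_squared_quantile \<nu> p = inv_into {0<..} (cdf (chi_squared \<nu>)) p"


section \<open>Robust feasibility\<close>

definition uncertainty_set :: "real^'m \<Rightarrow> real \<Rightarrow> real^'m^'m \<Rightarrow> (real^'m) set" where
  "uncertainty_set a0 \<tau> A =
     {a. \<exists>z y. (\<forall>i. 0 < z $ i) \<and> a = diag_matrix a0 *v z \<and>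
           (\<forall>i. z $ i - ln (z $ i) - 1 \<le> y $ i) \<and> norm (A *v y) \<le> \<tau>}"

text \<open>Since \<open>f\<close> is arbitrary, the minimum over \<open>U\<close> need not be attained, nor be finite; it is read as
  the optimal value, an infimum in the extended reals.\<close>

definition robust_feasible ::
    "((real^'m) \<times> (real^'n) \<Rightarrow> real) \<Rightarrow> (real^'m) set \<Rightarrow> real^'n \<Rightarrow> bool" where
  "robust_feasible f U x \<longleftrightarrow> 0 \<le> (INF a\<in>U. ereal (f (a, x)))"

end

theory Submission
  imports Defs
begin

text \<open>Write \<open>ln a\<^sub>i = \<mu>ln\<^sub>i + s\<^sub>i w\<^sub>i\<close> with \<open>s\<^sub>i\<close> the standard deviation of \<open>ln a\<^sub>i\<close>, which is
  positive because \<open>Sln\<close> is invertible. The \<open>w\<^sub>i\<close> are independent standard normal variables, so \<open>\<parallel>w\<parallel>\<^sup>2\<close> is chi-squared with \<open>m\<close> degrees of freedom and the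
  event \<open>\<parallel>w\<parallel> \<le> \<delta>\<close> has probability exactly \<open>1 - \<epsilon>\<close> (lemmas \<open>sum_squares_chi_squared\<close> and
  \<open>chi_squared_quantile\<close>).

  On this event \<open>a\<close> lies in the uncertainty set, hence \<open>f (a, x) \<ge> 0\<close> by robust feasibility. Indeed
  \<open>a\<^sub>i = a0\<^sub>i z\<^sub>i\<close> with \<open>z\<^sub>i = exp (s\<^sub>i w\<^sub>i)\<close>, and with \<open>y\<^sub>i = z\<^sub>i - ln z\<^sub>i - 1\<close> the elementary bound
  \<open>exp u - u - 1 \<le> \<bar>u\<bar> (exp \<bar>u\<bar> - 1)\<close> gives \<open>0 \<le> y\<^sub>i / s\<^sub>i \<le> \<bar>w\<^sub>i\<bar> (exp (s\<^sub>i \<bar>w\<^sub>i\<bar>) - 1)\<close>. Since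
  \<open>s\<^sub>i \<le> sqrt lam\<close> and \<open>\<bar>w\<^sub>i\<bar> \<le> \<delta>\<close>, the vector with entries \<open>y\<^sub>i / s\<^sub>i\<close> has norm at most
  \<open>\<delta> (exp (sqrt lam \<delta>) - 1) \<le> \<tau>\<close> (lemma \<open>exp_scaled_in_uncertainty_set\<close>).

  That these entries are those of \<open>A y\<close> is the matrix part: independence makes \<open>Sln\<close> the diagonal
  matrix of the variances, its principal square root is the diagonal matrix of the \<open>s\<^sub>i\<close>, and its
  largest eigenvalue bounds every variance.\<close>

section \<open>Diagonal matrices\<close>

lemma diag_matrix_mult_vec: "(diag_matrix d *v v) $ i = d $ i * v $ i"
  by (simp add: diag_matrix_def matrix_vector_mult_def if_distrib[of "\<lambda>x. x * _"] cong: if_cong)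

lemma diag_matrix_mult: "diag_matrix c ** diag_matrix d = diag_matrix (\<chi> i. c $ i * d $ i)"
  by (simp add: matrix_eq vec_eq_iff diag_matrix_mult_vec flip: matrix_vector_mul_assoc)

lemma diag_matrix_one: "diag_matrix (\<chi> i. 1) = mat 1"
  by (simp add: matrix_eq vec_eq_iff diag_matrix_mult_vec)

text \<open>The unit vectors are eigenvectors. As \<open>max_eigenvalue\<close> is a \<open>Max\<close>, the set of eigenvalues must
  also be shown finite: it consists of diagonal entries.\<close>

lemma max_eigenvalue_diag_ge: "d $ i \<le> max_eigenvalue (diag_matrix d)"
proof -
  have "{c. \<exists>v. v \<noteq> 0 \<and> diag_matrix d *v v = c *\<^sub>R v} \<subseteq> range (($) d)"
    by (force simp: vec_eq_iff diag_matrix_mult_vec)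
  then have "finite {c. \<exists>v. v \<noteq> 0 \<and> diag_matrix d *v v = c *\<^sub>R v}"
    by (rule finite_subset) simp
  moreover have "diag_matrix d *v axis i 1 = d $ i *\<^sub>R axis i 1"
    by (simp add: vec_eq_iff diag_matrix_mult_vec axis_def)
  then have "d $ i \<in> {c. \<exists>v. v \<noteq> 0 \<and> diag_matrix d *v v = c *\<^sub>R v}"
    by (auto intro!: exI[of _ "axis i 1"] simp: axis_eq_0_iff)
  ultimately show ?thesis
    unfolding max_eigenvalue_def by (rule Max_ge)
qed

text \<open>Uniqueness: if \<open>B\<close> is positive semidefinite with \<open>B\<^sup>2 = diag (s\<^sub>i\<^sup>2)\<close>, then
  \<open>(B + s\<^sub>i) (B - s\<^sub>i) e\<^sub>i = 0\<close>, so \<open>w = (B - s\<^sub>i) e\<^sub>i\<close> would be an eigenvector of \<open>B\<close> for the negative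
  eigenvalue \<open>- s\<^sub>i\<close> unless it vanishes. Hence \<open>B\<close> agrees with \<open>diag s\<close> on the standard basis.\<close>

lemma matrix_sqrt_diag:
  assumes "\<And>i. 0 < s $ i"
  shows "matrix_sqrt (diag_matrix (\<chi> i. (s $ i)\<^sup>2)) = diag_matrix s"
  unfolding matrix_sqrt_def
proof (rule the_equality)
  have "transpose (diag_matrix s) = diag_matrix s"
    by (auto simp: transpose_def diag_matrix_def vec_eq_iff)
  moreover have "0 \<le> v \<bullet> (diag_matrix s *v v)" for v
    by (auto simp: inner_vec_def diag_matrix_mult_vec mult.left_commute[of "v $ _"]
        less_imp_le[OF assms] intro!: sum_nonneg)
  ultimately show "psd (diag_matrix s) \<and>
      diag_matrix s ** diag_matrix s = diag_matrix (\<chi> i. (s $ i)\<^sup>2)"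
    by (simp add: psd_def diag_matrix_mult power2_eq_square)
next
  fix B assume B: "psd B \<and> B ** B = diag_matrix (\<chi> i. (s $ i)\<^sup>2)"
  have "B *v axis i 1 = diag_matrix s *v axis i 1" for i
  proof -
    define w where "w = B *v axis i 1 - s $ i *\<^sub>R axis i 1"
    have "B *v (B *v axis i 1) = (s $ i)\<^sup>2 *\<^sub>R axis i 1"
      unfolding matrix_vector_mul_assoc conjunct2[OF B]
      by (simp add: vec_eq_iff diag_matrix_mult_vec axis_def)
    then have "B *v w = - s $ i *\<^sub>R w"
      by (simp add: w_def matrix_vector_mult_diff_distrib matrix_vector_mult_scaleR
          power2_eq_square algebra_simps)
    moreover have "0 \<le> w \<bullet> (B *v w)"
      using B by (simp add: psd_def)
    ultimately have "w \<bullet> w \<le> 0"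
      using assms[of i] by (simp add: mult_le_0_iff)
    then have "w = 0"
      by (metis inner_eq_zero_iff inner_ge_zero order_antisym)
    then show ?thesis
      by (simp add: w_def vec_eq_iff diag_matrix_mult_vec axis_def)
  qed
  then show "B = diag_matrix s"
    by (simp only: matrix_vector_mult_basis) (simp add: column_def vec_eq_iff)
qed

lemma matrix_inv_diag:
  assumes "\<And>i. s $ i \<noteq> 0"
  shows "matrix_inv (diag_matrix s) = diag_matrix (\<chi> i. 1 / s $ i)"
proof -
  let ?D = "diag_matrix (\<chi> i. 1 / s $ i)"
  have inverse: "diag_matrix s ** ?D = mat 1" "?D ** diag_matrix s = mat 1"
    by (simp_all add: diag_matrix_mult assms diag_matrix_one)
  then have "diag_matrix s ** matrix_inv (diag_matrix s) = mat 1"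
    unfolding matrix_inv_def by (metis (mono_tags, lifting) someI)
  then show ?thesis
    by (metis inverse(2) matrix_mul_assoc matrix_mul_lid matrix_mul_rid)
qed

lemma invertible_diag_nonzero:
  fixes d :: "real^'m"
  assumes "invertible (diag_matrix d)"
  shows "d $ i \<noteq> 0"
proof
  assume "d $ i = 0"
  then have "diag_matrix d *v axis i 1 = diag_matrix d *v 0"
    by (simp add: vec_eq_iff diag_matrix_mult_vec axis_def)
  then have "axis i 1 = (0 :: real^'m)"
    by (rule injD[OF inj_matrix_vector_mult[OF assms]])
  then show False
    by (simp add: axis_eq_0_iff)
qed

section \<open>The chi-squared distribution\<close>

abbreviation std_normal :: "real measure" where
  "std_normal \<equiv> density lborel std_normal_density"

lemma real_distribution_chi_squared: "real_distribution (chi_squared \<nu>)"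
proof -
  interpret product_prob_space "\<lambda>_. std_normal" "{..<\<nu>}"
    by (simp add: product_prob_space_def product_prob_space_axioms_def product_sigma_finite_def
        prob_space_normal_density prob_space_imp_sigma_finite)
  show ?thesis
    unfolding chi_squared_def by (rule P.real_distribution_distr) measurable
qed

text \<open>Fubini: once all but the last of the normal variables are fixed, the last one has to satisfy a
  quadratic equation, whose at most two solutions form a null set.\<close>

lemma chi_squared_no_atoms:
  assumes "0 < \<nu>"
  shows "measure (chi_squared \<nu>) {c} = 0"
proof -
  obtain n where n: "\<nu> = Suc n"
    using assms gr0_implies_Suc by blast
  interpret product_prob_space "\<lambda>_ :: nat. std_normal" "{..<\<nu>}"
    by (simp add: product_prob_space_def product_prob_space_axioms_def product_sigma_finite_def
        prob_space_normal_density prob_space_imp_sigma_finite)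
  have null: "emeasure std_normal {y. r + y\<^sup>2 = c} = 0" for r
  proof -
    have "{y. r + y\<^sup>2 = c} \<subseteq> {sqrt (c - r), - sqrt (c - r)}"
      using real_sqrt_abs by (auto simp: abs_if split: if_splits)
    then have "finite {y. r + y\<^sup>2 = c}"
      by (rule finite_subset) simp
    then have "{y. r + y\<^sup>2 = c} \<in> null_sets lborel"
      by (simp add: finite_imp_null_set_lborel)
    moreover have "absolutely_continuous lborel std_normal"
      by (intro absolutely_continuousI_density) simp
    ultimately show ?thesis
      by (auto simp: absolutely_continuous_def)
  qed
  have "emeasure (chi_squared \<nu>) {c}
      = (\<integral>\<^sup>+ g. indicator {c} (\<Sum>i<\<nu>. (g i)\<^sup>2) \<partial>Pi\<^sub>M {..<\<nu>} (\<lambda>_. std_normal))"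
    unfolding chi_squared_def
    by (subst nn_integral_indicator[symmetric], simp, subst nn_integral_distr) auto
  also have "\<dots> = (\<integral>\<^sup>+ g. \<integral>\<^sup>+ y. indicator {c} (\<Sum>i<\<nu>. ((g(n := y)) i)\<^sup>2) \<partial>std_normal
      \<partial>Pi\<^sub>M {..<n} (\<lambda>_. std_normal))"
    unfolding n lessThan_Suc by (rule product_nn_integral_insert) auto
  also have "\<dots> = (\<integral>\<^sup>+ g. emeasure std_normal {y. (\<Sum>i<n. (g i)\<^sup>2) + y\<^sup>2 = c}
      \<partial>Pi\<^sub>M {..<n} (\<lambda>_. std_normal))"
  proof (rule nn_integral_cong)
    fix g :: "nat \<Rightarrow> real"
    have "(\<integral>\<^sup>+ y. indicator {c} (\<Sum>i<\<nu>. ((g(n := y)) i)\<^sup>2) \<partial>std_normal)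
        = (\<integral>\<^sup>+ y. indicator {y. (\<Sum>i<n. (g i)\<^sup>2) + y\<^sup>2 = c} y \<partial>std_normal)"
      by (rule nn_integral_cong) (auto simp: n indicator_def)
    then show "(\<integral>\<^sup>+ y. indicator {c} (\<Sum>i<\<nu>. ((g(n := y)) i)\<^sup>2) \<partial>std_normal)
        = emeasure std_normal {y. (\<Sum>i<n. (g i)\<^sup>2) + y\<^sup>2 = c}"
      by (simp add: nn_integral_indicator)
  qed
  finally show ?thesis
    by (simp add: null measure_def)
qed

text \<open>The quantile is an \<open>inv_into\<close> on the positive reals, so its defining property needs the level
  \<open>p\<close> to be attained there. The distribution function is continuous because there are no atoms, and it
  rises from \<open>0\<close> at \<open>0\<close> to the limit \<open>1\<close> at infinity, so the intermediate value theorem applies.\<close>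

lemma chi_squared_quantile:
  assumes "0 < \<nu>" "0 < p" "p < 1"
  shows "0 < chi_squared_quantile \<nu> p" "cdf (chi_squared \<nu>) (chi_squared_quantile \<nu> p) = p"
proof -
  interpret real_distribution "chi_squared \<nu>"
    by (rule real_distribution_chi_squared)
  have "\<not> (\<Sum>i<\<nu>. (g i)\<^sup>2) < 0" for g :: "nat \<Rightarrow> real"
    by (simp add: not_less sum_nonneg)
  then have "measure (chi_squared \<nu>) {..<0} = 0"
    unfolding chi_squared_def by (subst measure_distr) (auto simp: vimage_def)
  then have "cdf (chi_squared \<nu>) 0 = 0"
    unfolding cdf_def2 ivl_disj_un_singleton(2)[symmetric]
    by (subst finite_measure_Union) (auto simp: chi_squared_no_atoms assms)
  moreover obtain b where "p < cdf (chi_squared \<nu>) b"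
    using order_tendstoD(1)[OF cdf_lim_at_top_prob \<open>p < 1\<close>] by (auto simp: eventually_at_top_linorder)
  moreover from calculation have "0 < b"
    using cdf_nondecreasing[of b 0] \<open>0 < p\<close> by (cases "0 < b") auto
  moreover have "continuous_on UNIV (cdf (chi_squared \<nu>))"
    by (simp add: continuous_on_eq_continuous_at isCont_cdf chi_squared_no_atoms assms)
  ultimately obtain q where "0 \<le> q" "cdf (chi_squared \<nu>) q = p"
    using IVT'[of "cdf (chi_squared \<nu>)" 0 p b] \<open>0 < p\<close> continuous_on_subset by (metis less_imp_le subset_UNIV)
  with \<open>cdf (chi_squared \<nu>) 0 = 0\<close> \<open>0 < p\<close> have "p \<in> cdf (chi_squared \<nu>) ` {0<..}"
    by (cases "q = 0") auto
  from f_inv_into_f[OF this] inv_into_into[OF this]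
  show "0 < chi_squared_quantile \<nu> p" "cdf (chi_squared \<nu>) (chi_squared_quantile \<nu> p) = p"
    by (simp_all add: chi_squared_quantile_def)
qed

text \<open>\<open>chi_squared\<close> is built from a product indexed by \<open>{..<\<nu>}\<close>, whereas the components of a random
  vector are indexed by a finite type; the joint law is transported along an enumeration of the
  type.\<close>

lemma (in prob_space) sum_squares_chi_squared:
  fixes W :: "'i::finite \<Rightarrow> 'a \<Rightarrow> real"
  assumes indep: "indep_vars (\<lambda>_. borel) W UNIV"
    and normal: "\<And>i. distributed M lborel (W i) std_normal_density"
  shows "distr M borel (\<lambda>\<omega>. \<Sum>i\<in>UNIV. (W i \<omega>)\<^sup>2) = chi_squared CARD('i)"
proof -
  let ?n = "CARD('i)"
  obtain h where h: "bij_betw h {..<?n} (UNIV :: 'i set)"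
    using ex_bij_betw_nat_finite[OF finite_class.finite_UNIV] by (metis atLeast0LessThan)
  have W[measurable]: "W i \<in> borel_measurable M" for i
    using normal distributed_measurable by fastforce
  have d: "distr M borel (W i) = std_normal" for i
    using distributed_distr_eq_density[OF normal[of i]] by (simp cong: distr_cong)
  have "distr M (Pi\<^sub>M UNIV (\<lambda>_. borel)) (\<lambda>\<omega> i. W i \<omega>) = Pi\<^sub>M UNIV (\<lambda>_. std_normal)"
    using indep by (subst (asm) indep_vars_iff_distr_eq_PiM) (simp_all add: d restrict_UNIV)
  moreover have "distr (Pi\<^sub>M UNIV (\<lambda>_ :: 'i. std_normal)) (Pi\<^sub>M {..<?n} (\<lambda>_. std_normal))
      (\<lambda>g. \<lambda>j\<in>{..<?n}. g (h j)) = Pi\<^sub>M {..<?n} (\<lambda>_. std_normal)"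
    using h by (intro distr_PiM_reindex) (auto simp: bij_betw_def prob_space_normal_density)
  ultimately have "chi_squared ?n = distr (distr (distr M (Pi\<^sub>M UNIV (\<lambda>_. borel)) (\<lambda>\<omega> i. W i \<omega>))
      (Pi\<^sub>M {..<?n} (\<lambda>_. std_normal)) (\<lambda>g. \<lambda>j\<in>{..<?n}. g (h j))) borel (\<lambda>g. \<Sum>i<?n. (g i)\<^sup>2)"
    by (simp add: chi_squared_def)
  also have "\<dots> = distr (distr M (Pi\<^sub>M UNIV (\<lambda>_. borel)) (\<lambda>\<omega> i. W i \<omega>)) borel
      (\<lambda>g. \<Sum>i<?n. (g (h i))\<^sup>2)"
    by (subst distr_distr) (auto simp: comp_def intro!: distr_cong)
  also have "\<dots> = distr M borel (\<lambda>\<omega>. \<Sum>i<?n. (W (h i) \<omega>)\<^sup>2)"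
  proof (subst distr_distr)
    show "(\<lambda>\<omega> i. W i \<omega>) \<in> measurable M (Pi\<^sub>M UNIV (\<lambda>_. borel))"
      by (rule measurable_PiM_single') auto
  qed (auto simp: comp_def intro!: distr_cong)
  also have "(\<lambda>\<omega>. \<Sum>i<?n. (W (h i) \<omega>)\<^sup>2) = (\<lambda>\<omega>. \<Sum>i\<in>UNIV. (W i \<omega>)\<^sup>2)"
    using sum.reindex_bij_betw[OF h] by fastforce
  finally show ?thesis ..
qed

section \<open>Normal variables and covariance under independence\<close>

lemma (in prob_space) normal_rv_integrable:
  assumes "normal_rv M X"
  shows "integrable M X"
  using assms unfolding normal_rv_def
proof (elim disjE exE conjE)
  fix m \<sigma> assume "0 < \<sigma>" and "distributed M lborel X (normal_density m \<sigma>)"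
  then show ?thesis
    using distributed_integrable[of M lborel X "normal_density m \<sigma>" "\<lambda>x. x"]
      integrable_normal_moment_nz_1[of \<sigma> m] by simp
next
  fix m assume "X \<in> borel_measurable M" "AE \<omega> in M. X \<omega> = m"
  then show ?thesis
    using integrable_cong_AE[of X M "\<lambda>_. m"] by simp
qed

text \<open>\<open>normal_rv\<close> admits constants; nonzero variance rules them out.\<close>

lemma (in prob_space) normal_rv_standardize:
  assumes "normal_rv M X" and "variance X \<noteq> 0"
  shows "0 < variance X"
    and "distributed M lborel (\<lambda>\<omega>. (X \<omega> - expectation X) / sqrt (variance X)) std_normal_density"
proof -
  have "\<exists>\<sigma>>0. distributed M lborel X (normal_density (expectation X) \<sigma>) \<and> variance X = \<sigma>\<^sup>2"
    using assms(1) unfolding normal_rv_def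
  proof (elim disjE exE conjE)
    fix m \<sigma> assume *: "0 < \<sigma>" "distributed M lborel X (normal_density m \<sigma>)"
    then show ?thesis
      using normal_distributed_expectation[OF *] normal_distributed_variance[OF *] by auto
  next
    fix m assume [measurable]: "X \<in> borel_measurable M" and ae: "AE \<omega> in M. X \<omega> = m"
    have "expectation X = m"
      using integral_cong_AE[of X M "\<lambda>_. m"] ae by (simp add: prob_space)
    then have "variance X = 0"
      by (intro integral_eq_zero_AE) (use ae in auto)
    with assms(2) show ?thesis by simp
  qed
  then obtain \<sigma> where \<sigma>: "0 < \<sigma>" "distributed M lborel X (normal_density (expectation X) \<sigma>)"
    "variance X = \<sigma>\<^sup>2" by blast
  then show "0 < variance X"
    and "distributed M lborel (\<lambda>\<omega>. (X \<omega> - expectation X) / sqrt (variance X)) std_normal_density"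
    using \<sigma>(1) normal_standard_normal_convert[THEN iffD1, OF \<sigma>(1,2)] unfolding \<sigma>(3) by simp_all
qed

lemma covariance_matrix_indep:
  fixes X :: "'w \<Rightarrow> real^'m"
  assumes "prob_space M"
    and indep: "prob_space.indep_vars M (\<lambda>_. borel) (\<lambda>i \<omega>. X \<omega> $ i) UNIV"
    and int: "\<And>i. integrable M (\<lambda>\<omega>. X \<omega> $ i)"
  shows "covariance_matrix M X
    = diag_matrix (\<chi> i. \<integral>\<omega>. (X \<omega> $ i - (\<integral>\<omega>. X \<omega> $ i \<partial>M))\<^sup>2 \<partial>M)"
proof -
  interpret prob_space M by fact
  let ?Y = "\<lambda>i \<omega>. X \<omega> $ i - expectation (\<lambda>\<omega>. X \<omega> $ i)"
  have "expectation (\<lambda>\<omega>. ?Y i \<omega> * ?Y j \<omega>) = 0" if "i \<noteq> j" for i j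
  proof -
    have "indep_vars (\<lambda>_. borel) ?Y {i, j}"
      by (rule indep_vars_subset[OF indep_vars_compose2[OF indep]]) auto
    then have "expectation (\<lambda>\<omega>. \<Prod>k\<in>{i, j}. ?Y k \<omega>) = (\<Prod>k\<in>{i, j}. expectation (?Y k))"
      by (intro indep_vars_lebesgue_integral) (auto simp: int)
    with that show ?thesis
      by (simp add: int prob_space)
  qed
  then show ?thesis
    by (simp add: covariance_matrix_def mean_vector_def diag_matrix_def vec_eq_iff power2_eq_square)
qed

section \<open>Probability of robust constraints\<close>

text \<open>From \<open>1 - u \<le> exp (- u)\<close> follows \<open>exp u - u - 1 \<le> u (exp u - 1)\<close> for either sign of \<open>u\<close>, and
  \<open>u\<close> and \<open>exp u - 1\<close> have the same sign; so only \<open>\<bar>exp u - 1\<bar> \<le> exp \<bar>u\<bar> - 1\<close> remains.\<close>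

lemma exp_minus_linear_bound: "exp u - u - 1 \<le> \<bar>u\<bar> * (exp \<bar>u\<bar> - 1)" for u :: real
proof -
  have "1 - u \<le> exp (- u)"
    using exp_ge_add_one_self[of "- u"] by simp
  then have "exp u * (1 - u) \<le> 1"
    using mult_left_mono[of "1 - u" "exp (- u)" "exp u"] by (simp add: exp_minus)
  then have "exp u - u - 1 \<le> u * (exp u - 1)"
    by (simp add: algebra_simps)
  also have "\<dots> \<le> \<bar>u\<bar> * \<bar>exp u - 1\<bar>"
    by (metis abs_ge_self abs_mult)
  also have "\<bar>exp u - 1\<bar> \<le> exp \<bar>u\<bar> - 1"
  proof (cases "0 \<le> u")
    case False
    \<comment> \<open>For negative \<open>u\<close> the claim is \<open>1 - exp u \<le> exp (- u) - 1\<close>, that is \<open>cosh u \<ge> 1\<close>.\<close>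
    have "2 \<le> exp u + exp (- u)"
      using cosh_real_ge_1[of u] by (simp add: cosh_def)
    with False show ?thesis by simp
  qed simp
  finally show ?thesis by (simp add: mult_left_mono)
qed

text \<open>The deterministic half of the argument. The witnesses take the constraints on \<open>y\<close> with equality,
  and each entry \<open>y\<^sub>i / s\<^sub>i\<close> of \<open>A y\<close> is dominated by \<open>(exp (l r) - 1) \<bar>w\<^sub>i\<bar>\<close>, so the norm bound for
  \<open>w\<close> passes to \<open>A y\<close> with the factor \<open>exp (l r) - 1\<close>.\<close>

lemma exp_scaled_in_uncertainty_set:
  fixes w s :: "real^'m"
  assumes s: "\<And>i. 0 < s $ i" "\<And>i. s $ i \<le> l" and r: "(\<Sum>i\<in>UNIV. (w $ i)\<^sup>2) \<le> r\<^sup>2" "0 \<le> r"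
    and \<tau>: "r * (exp (l * r) - 1) \<le> \<tau>"
    and a: "\<And>i. a $ i = a0 $ i * exp (s $ i * w $ i)"
  shows "a \<in> uncertainty_set a0 \<tau> (diag_matrix (\<chi> i. 1 / s $ i))"
proof -
  define z y :: "real^'m" where "z = (\<chi> i. exp (s $ i * w $ i))"
    and "y = (\<chi> i. z $ i - ln (z $ i) - 1)"
  let ?k = "exp (l * r) - 1"
  \<comment> \<open>The index type is nonempty, so some \<open>s $ i\<close> lies below \<open>l\<close>.\<close>
  have l: "0 < l"
    using s[of undefined] by linarith
  have "norm w \<le> r"
    using r by (auto simp: norm_vec_def L2_set_def intro: real_le_lsqrt sum_nonneg)
  then have w: "\<bar>w $ i\<bar> \<le> r" for i
    using component_le_norm_cart[of w i] by linarith
  have "\<bar>(diag_matrix (\<chi> i. 1 / s $ i) *v y) $ i\<bar> \<le> \<bar>(?k *\<^sub>R w) $ i\<bar>" for i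
  proof -
    have sw: "\<bar>s $ i * w $ i\<bar> \<le> l * r"
      using s[of i] w[of i] l by (simp add: abs_mult mult_mono)
    have "y $ i \<le> \<bar>s $ i * w $ i\<bar> * (exp \<bar>s $ i * w $ i\<bar> - 1)"
      using exp_minus_linear_bound by (simp add: y_def z_def)
    also have "\<dots> \<le> \<bar>s $ i * w $ i\<bar> * ?k"
      using sw by (intro mult_left_mono) auto
    finally have "y $ i / s $ i \<le> ?k * \<bar>w $ i\<bar>"
      using s(1)[of i] by (simp add: abs_mult field_simps)
    moreover have "0 \<le> y $ i"
      using exp_ge_add_one_self[of "s $ i * w $ i"] by (simp add: y_def z_def del: exp_ge_add_one_self)
    ultimately show ?thesis
      using s(1)[of i] l r by (simp add: diag_matrix_mult_vec abs_mult)
  qed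
  then have "norm (diag_matrix (\<chi> i. 1 / s $ i) *v y) \<le> norm (?k *\<^sub>R w)"
    by (intro norm_le_componentwise_cart) (simp only: real_norm_def)
  also have "\<dots> \<le> ?k * r"
    using \<open>norm w \<le> r\<close> l r by (simp add: mult_left_mono)
  finally have "norm (diag_matrix (\<chi> i. 1 / s $ i) *v y) \<le> \<tau>"
    using \<tau> by (simp add: mult.commute)
  then show ?thesis
    unfolding uncertainty_set_def
    by (intro CollectI exI[of _ z] exI[of _ y])
       (simp add: y_def z_def vec_eq_iff diag_matrix_mult_vec a)
qed

theorem theorem4p11:
  fixes M :: "'w measure"
    and a :: "'w \<Rightarrow> real^'m"
    and \<mu> \<mu>ln a0 :: "real^'m"
    and S Sln A :: "real^'m^'m"
    and f :: "(real^'m) \<times> (real^'n) \<Rightarrow> real"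
    and \<epsilon> \<delta> lam \<tau> :: real
    and x :: "real^'n"
  assumes "prob_space M"
    and "lognormal_vector M a \<mu> S"
    and "prob_space.indep_vars M (\<lambda>_. borel) (\<lambda>i \<omega>. a \<omega> $ i) UNIV"
    and "\<mu>ln = mean_vector M (\<lambda>\<omega>. vec_ln (a \<omega>))"
    and "Sln = covariance_matrix M (\<lambda>\<omega>. vec_ln (a \<omega>))"
    and "invertible Sln"
    and "lam = max_eigenvalue Sln"
    and "a0 = (\<chi> i. exp (\<mu>ln $ i))"
    and "A = matrix_inv (matrix_sqrt Sln)"
    and "0 < \<epsilon>" and "\<epsilon> < 1"
    and "\<delta> = sqrt (chi_squared_quantile CARD('m) (1 - \<epsilon>))"
    and "\<tau> \<ge> \<delta> * (exp (sqrt lam * \<delta>) - 1)"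
    and "robust_feasible f (uncertainty_set a0 \<tau> A) x"
    and "{\<omega> \<in> space M. f (a \<omega>, x) \<ge> 0} \<in> sets M"
  shows "measure M {\<omega> \<in> space M. f (a \<omega>, x) \<ge> 0} \<ge> 1 - \<epsilon>"
proof -
  interpret prob_space M by fact
  define X where "X = (\<lambda>\<omega>. vec_ln (a \<omega>))"
  define v where "v = (\<lambda>i. variance (\<lambda>\<omega>. X \<omega> $ i))"
  define s where "s = (\<chi> i. sqrt (v i))"
  define w where "w = (\<lambda>\<omega>. \<chi> i. (X \<omega> $ i - \<mu>ln $ i) / s $ i)"
  define q where "q = chi_squared_quantile CARD('m) (1 - \<epsilon>)"
  have pos: "0 < a \<omega> $ i" if "\<omega> \<in> space M" for \<omega> i
    using assms(2) that by (auto simp: lognormal_vector_def)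
  have "normal_rv M (\<lambda>\<omega>. axis i 1 \<bullet> X \<omega>)" for i
    using assms(2) by (simp only: lognormal_vector_def multivariate_normal_def X_def)
  then have normal: "normal_rv M (\<lambda>\<omega>. X \<omega> $ i)" for i
    by (simp add: inner_axis')
  have "indep_vars (\<lambda>_. borel) (\<lambda>i \<omega>. ln (a \<omega> $ i)) UNIV"
    by (rule indep_vars_compose2[OF assms(3)]) simp
  then have indep: "indep_vars (\<lambda>_. borel) (\<lambda>i \<omega>. X \<omega> $ i) UNIV"
    by (simp add: X_def vec_ln_def)
  have mean: "\<mu>ln $ i = expectation (\<lambda>\<omega>. X \<omega> $ i)" for i
    by (simp add: assms(4) mean_vector_def X_def)
  have Sln: "Sln = diag_matrix (\<chi> i. v i)"
    unfolding assms(5) v_def using covariance_matrix_indep[OF \<open>prob_space M\<close> indep] normal_rv_integrable[OF normal]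
    by (simp add: X_def)
  have v: "0 < v i" for i
    using normal_rv_standardize(1)[OF normal] invertible_diag_nonzero[of "\<chi> i. v i" i] assms(6)
    by (simp add: Sln v_def)
  then have s: "0 < s $ i" "(s $ i)\<^sup>2 = v i" for i
    by (simp_all add: s_def less_imp_le)
  have Sln_sq: "Sln = diag_matrix (\<chi> i. (s $ i)\<^sup>2)"
    by (simp add: Sln s)
  have s_le: "s $ i \<le> sqrt lam" for i
    using max_eigenvalue_diag_ge[of "\<chi> i. v i" i] by (simp add: s_def assms(7) Sln)
  have A: "A = diag_matrix (\<chi> i. 1 / s $ i)"
    using s(1) by (simp add: assms(9) Sln_sq matrix_sqrt_diag matrix_inv_diag less_imp_neq[symmetric])
  have std: "distributed M lborel (\<lambda>\<omega>. w \<omega> $ i) std_normal_density" for i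
    using normal_rv_standardize(2)[OF normal] v[of i] by (simp add: w_def mean s_def v_def)
  have [measurable]: "(\<lambda>\<omega>. w \<omega> $ i) \<in> borel_measurable M" for i
    using distributed_measurable[OF std[of i]] by simp
  have "indep_vars (\<lambda>_. borel) (\<lambda>i \<omega>. (X \<omega> $ i - \<mu>ln $ i) / s $ i) UNIV"
    by (rule indep_vars_compose2[OF indep]) simp
  then have chi: "distr M borel (\<lambda>\<omega>. \<Sum>i\<in>UNIV. (w \<omega> $ i)\<^sup>2) = chi_squared CARD('m)"
    using std by (intro sum_squares_chi_squared) (simp_all add: w_def)
  have q: "0 < q" "cdf (chi_squared CARD('m)) q = 1 - \<epsilon>"
    using chi_squared_quantile[of "CARD('m)" "1 - \<epsilon>"] assms(10,11) by (simp_all add: q_def)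
  \<comment> \<open>As \<open>q\<close> is positive, \<open>\<delta>\<^sup>2 = q\<close>, so the event \<open>\<parallel>w\<parallel>\<^sup>2 \<le> q\<close> is \<open>\<parallel>w\<parallel> \<le> \<delta>\<close>.\<close>
  have "f (a \<omega>, x) \<ge> 0" if \<omega>: "\<omega> \<in> space M" and le: "(\<Sum>i\<in>UNIV. (w \<omega> $ i)\<^sup>2) \<le> q" for \<omega>
  proof -
    have "a \<omega> $ i = a0 $ i * exp (s $ i * w \<omega> $ i)" for i
      using s(1)[of i] pos[OF \<omega>, of i] by (simp add: w_def assms(8) X_def vec_ln_def exp_diff)
    then have "a \<omega> \<in> uncertainty_set a0 \<tau> A"
      unfolding A using s(1) s_le le q(1) assms(12,13)
      by (intro exp_scaled_in_uncertainty_set[where r = \<delta> and w = "w \<omega>" and l = "sqrt lam"]) (auto simp: q_def)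
    then have "0 \<le> ereal (f (a \<omega>, x))"
      using assms(14) unfolding robust_feasible_def le_INF_iff by blast
    then show ?thesis by simp
  qed
  then have "{\<omega> \<in> space M. (\<Sum>i\<in>UNIV. (w \<omega> $ i)\<^sup>2) \<le> q} \<subseteq> {\<omega> \<in> space M. f (a \<omega>, x) \<ge> 0}"
    by blast
  then have "prob {\<omega> \<in> space M. (\<Sum>i\<in>UNIV. (w \<omega> $ i)\<^sup>2) \<le> q} \<le> prob {\<omega> \<in> space M. f (a \<omega>, x) \<ge> 0}"
    using assms(15) by (rule finite_measure_mono)
  moreover have "prob {\<omega> \<in> space M. (\<Sum>i\<in>UNIV. (w \<omega> $ i)\<^sup>2) \<le> q} = 1 - \<epsilon>"
    using q(2) unfolding chi[symmetric] cdf_def2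
    by (subst (asm) measure_distr) (simp_all add: vimage_def Int_def conj_commute)
  ultimately show ?thesis by simp
qed

end
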